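(* Let $\delta_{EB}^{\ast}=\left(1-\frac{p-2}{n+2}\frac{S^{2}}{\|X-\nu\|^{2}}\right)(X-\nu)+\nu$ be the Empirical Modified Bayes estimator. Then: (a) If $p\geq 3$, the estimator $\delta_{EB}^{\ast}$ is minimax, in the sense that $R(\delta_{EB}^{\ast};\nu,\tau^{2},\sigma^{2})\leq R(X)=p\sigma^{2}$ for all $\nu\in\mathbb{R}^p$, $\tau^2>0$, $\sigma^2>0$. (b) For fixed $\sigma^2>0$ and $\tau^2>0$, $$\lim_{n,p\to\infty}\frac{R(\delta_{EB}^{\ast};\nu,\tau^{2},\sigma^{2})}{R(X)}=\frac{\tau^{2}}{\tau^{2}+\sigma^{2}},$$ where $n$ and $p$ tend simultaneously to infinity, with no order relation or functional relation assumed between them.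
   Context: Setting: $p,n\geq 1$ are integers, $\sigma^2>0$, $\tau^2>0$, $\nu\in\mathbb{R}^p$. The random vector $\theta$ has prior distribution $N_p(\nu,\tau^2 I_p)$; conditionally on $\theta$, $X\sim N_p(\theta,\sigma^2 I_p)$; and $S^2$ is a random variable independent of $(X,\theta)$ with $S^2\sim\sigma^2\chi_n^2$ (i.e. $S^2/\sigma^2$ is central chi-square with $n$ degrees of freedom). $\sigma^2$ and $\tau^2$ are unknown to the statistician, while $\nu$ is known. For an estimator $\delta=\delta(X,S^2)$ of $\theta$, its quadratic risk given $\theta$ is $R(\delta,\theta)=E_\theta\|\delta-\theta\|^2$ (expectation over $(X,S^2)$ given $\theta$), and $R(\delta;\nu,\tau^2,\sigma^2)=E_{\theta\sim N_p(\nu,\tau^2 I_p)}[R(\delta,\theta)]=E\|\delta-\theta\|^2$ is the risk averaged over the prior. The risk of the maximum likelihood estimator $X$ is $R(X)=p\sigma^2$. In this Bayesian setting an estimator is called minimax when its risk $R(\delta;\nu,\tau^2,\sigma^2)$ never exceeds that of the minimax estimator $X$. *)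

theory Defs
  imports "HOL-Probability.Probability"
begin

text \<open>
  The dimension \<open>p\<close> varies in the statement, so a vector of \<open>\<real>\<^sup>p\<close> is represented by a
  function \<open>nat \<Rightarrow> real\<close> of which only the coordinates below \<open>p\<close> matter. The positive scale
  parameters \<open>\<sigma>\<close>, \<open>\<tau>\<close> are standard deviations; the variances are their squares.
\<close>

definition sq_norm :: "nat \<Rightarrow> (nat \<Rightarrow> real) \<Rightarrow> real" where
  "sq_norm p x = (\<Sum>i<p. (x i)\<^sup>2)"

text \<open>The law \<open>N\<^sub>p(\<mu>, s\<^sup>2 I\<^sub>p)\<close>; note that \<open>normal_density\<close> takes the standard deviation.\<close>

definition normal_vec :: "nat \<Rightarrow> (nat \<Rightarrow> real) \<Rightarrow> real \<Rightarrow> (nat \<Rightarrow> real) measure" where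
  "normal_vec p \<mu> s = (\<Pi>\<^sub>M i\<in>{..<p}. density lborel (\<lambda>x. ennreal (normal_density (\<mu> i) s x)))"

text \<open>
  The central chi-square law with \<open>n\<close> degrees of freedom, as the law of the sum of squares of
  \<open>n\<close> independent standard normal variables.
\<close>

definition chi_square :: "nat \<Rightarrow> real measure" where
  "chi_square n = distr (normal_vec n (\<lambda>_. 0) 1) borel (sq_norm n)"

text \<open>
  The conditional law of \<open>(X, S\<^sup>2)\<close> given \<open>\<theta>\<close>. Since \<open>S\<^sup>2\<close> is independent of \<open>(X, \<theta>)\<close>, it is
  the product of \<open>N\<^sub>p(\<theta>, \<sigma>\<^sup>2 I\<^sub>p)\<close> with the law of \<open>\<sigma>\<^sup>2 \<chi>\<^sup>2\<^sub>n\<close>.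
\<close>

definition sample_law ::
  "nat \<Rightarrow> nat \<Rightarrow> real \<Rightarrow> (nat \<Rightarrow> real) \<Rightarrow> ((nat \<Rightarrow> real) \<times> real) measure" where
  "sample_law p n \<sigma> \<theta> =
     normal_vec p \<theta> \<sigma> \<Otimes>\<^sub>M distr (chi_square n) borel (\<lambda>u. \<sigma>\<^sup>2 * u)"

type_synonym estimator = "(nat \<Rightarrow> real) \<Rightarrow> real \<Rightarrow> nat \<Rightarrow> real"

text \<open>
  Risks are \<open>ennreal\<close>-valued, so that a non-integrable loss gives risk \<open>\<infinity>\<close> instead of the
  default value 0 of the Bochner integral.
\<close>

definition risk ::
  "nat \<Rightarrow> nat \<Rightarrow> real \<Rightarrow> estimator \<Rightarrow> (nat \<Rightarrow> real) \<Rightarrow> ennreal" where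
  "risk p n \<sigma> \<delta> \<theta> =
     (\<integral>\<^sup>+ (x, s2). ennreal (sq_norm p (\<lambda>i. \<delta> x s2 i - \<theta> i)) \<partial>sample_law p n \<sigma> \<theta>)"

definition bayes_risk ::
  "nat \<Rightarrow> nat \<Rightarrow> (nat \<Rightarrow> real) \<Rightarrow> real \<Rightarrow> real \<Rightarrow> estimator \<Rightarrow> ennreal" where
  "bayes_risk p n \<nu> \<tau> \<sigma> \<delta> = (\<integral>\<^sup>+ \<theta>. risk p n \<sigma> \<delta> \<theta> \<partial>normal_vec p \<nu> \<tau>)"

definition mle :: estimator where
  "mle x s2 = x"

text \<open>The second argument of an estimator is the value of \<open>S\<^sup>2\<close>, not of \<open>S\<close>.\<close>

definition emp_mod_bayes :: "nat \<Rightarrow> nat \<Rightarrow> (nat \<Rightarrow> real) \<Rightarrow> estimator" where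
  "emp_mod_bayes p n \<nu> x s2 =
     (\<lambda>i. (1 - (real p - 2) / (real n + 2) * (s2 / sq_norm p (\<lambda>j. x j - \<nu> j)))
            * (x i - \<nu> i) + \<nu> i)"

end

theory Submission
  imports Defs
begin

text \<open>
  Let \<open>V = \<sigma>\<^sup>2 + \<tau>\<^sup>2\<close>, \<open>Y = X - \<nu>\<close>, \<open>b = \<sigma>\<^sup>2 / V\<close> and \<open>c = (p - 2) / (n + 2)\<close>. Both claims
  follow from an exact formula, valid for \<open>p \<ge> 3\<close>:
  the Bayes risk of the estimator is \<open>p \<sigma>\<^sup>2 - (\<sigma>\<^sup>4 / V) n (p - 2) / (n + 2)\<close>. The subtracted term is
  nonnegative, which is minimaxity; after division by \<open>p \<sigma>\<^sup>2\<close> the risk becomes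
  \<open>1 - b (n / (n + 2)) ((p - 2) / p)\<close>, in which the dependence on \<open>n\<close> and \<open>p\<close> is a product of
  a function of \<open>n\<close> and a function of \<open>p\<close>, both tending to 1, so that no relation between the
  two indices matters.

  The formula avoids Stein's identity by conditioning on the data instead of on the parameter.
  Given \<open>X\<close>, the coordinates of \<open>\<theta>\<close> are independent normal variables with means
  \<open>\<nu>\<^sub>i + (\<tau>\<^sup>2 / V) Y\<^sub>i\<close> and variance \<open>\<sigma>\<^sup>2 \<tau>\<^sup>2 / V\<close>, while \<open>Y\<close> has law \<open>N\<^sub>p(0, V I\<^sub>p)\<close>
  (\<open>nn_integral_prior_posterior_swap\<close>). So the risk of an estimator is the posterior variance
  \<open>p \<sigma>\<^sup>2 \<tau>\<^sup>2 / V\<close> plus its mean squared distance to the posterior mean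
  (\<open>bayes_risk_eq_posterior\<close>). Here the difference to the posterior mean is the multiple
  \<open>b - c S\<^sup>2 / \<parallel>Y\<parallel>\<^sup>2\<close> of \<open>Y\<close>, and its squared norm is
  \<open>b\<^sup>2 \<parallel>Y\<parallel>\<^sup>2 - 2 b c S\<^sup>2 + c\<^sup>2 S\<^sup>4 / \<parallel>Y\<parallel>\<^sup>2\<close>.

  What remains are four moments: \<open>E \<parallel>Y\<parallel>\<^sup>2 = p V\<close>, \<open>E S\<^sup>2 = n \<sigma>\<^sup>2\<close>, \<open>E S\<^sup>4 = n (n + 2) \<sigma>\<^sup>4\<close> and
  \<open>E (1 / \<parallel>Y\<parallel>\<^sup>2) = 1 / ((p - 2) V)\<close>. The last one comes from integrating the Laplace transform
  \<open>(1 + 2 t V) powr (- p / 2)\<close> of \<open>\<parallel>Y\<parallel>\<^sup>2\<close> over the half line. The whole computation is done with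
  nonnegative integrals, so that integrability needs no separate argument.
\<close>

section \<open>Products of normal laws\<close>

lemma prob_space_normal_vec:
  assumes "0 < s"
  shows "prob_space (normal_vec p \<mu> s)"
  unfolding normal_vec_def
  by (intro prob_space_PiM prob_space_normal_density assms)

lemma sets_normal_vec [measurable_cong]:
  "sets (normal_vec p \<mu> s) = sets (\<Pi>\<^sub>M i\<in>{..<p}. lborel)"
  unfolding normal_vec_def by (intro sets_PiM_cong) auto

lemma sq_norm_nonneg [simp]: "0 \<le> sq_norm p x"
  by (simp add: sq_norm_def sum_nonneg)

lemma measurable_sq_norm [measurable (raw)]:
  assumes "\<And>i. i < p \<Longrightarrow> (\<lambda>w. f w i) \<in> borel_measurable M"
  shows "(\<lambda>w. sq_norm p (f w)) \<in> borel_measurable M"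
  unfolding sq_norm_def using assms by (intro borel_measurable_sum borel_measurable_power) auto

lemma measurable_normal_density [measurable (raw)]:
  assumes "f \<in> borel_measurable M" "g \<in> borel_measurable M"
  shows "(\<lambda>w. normal_density (f w) s (g w)) \<in> borel_measurable M"
  unfolding normal_density_def using assms by measurable

text \<open>
  With a density with respect to Lebesgue measure on a fixed product space, integrals over laws whose
  means depend on another variable become iterated Lebesgue integrals, to which Tonelli's theorem
  applies.
\<close>

lemma normal_vec_eq_density:
  assumes s: "0 < s"
  shows "normal_vec p \<mu> s =
    density (\<Pi>\<^sub>M i\<in>{..<p}. lborel) (\<lambda>x. ennreal (\<Prod>i<p. normal_density (\<mu> i) s (x i)))"
proof -
  interpret L: product_sigma_finite "\<lambda>_::nat. lborel :: real measure" ..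
  let ?N = "\<lambda>i. density lborel (\<lambda>x. ennreal (normal_density (\<mu> i) s x))"
  interpret N: product_sigma_finite ?N
    by (intro product_sigma_finite.intro prob_space_imp_sigma_finite prob_space_normal_density s)
  show ?thesis
    unfolding normal_vec_def
  proof (rule N.PiM_eqI[symmetric])
    show "sets (density (\<Pi>\<^sub>M i\<in>{..<p}. lborel)
            (\<lambda>x. ennreal (\<Prod>i<p. normal_density (\<mu> i) s (x i)))) = sets (PiM {..<p} ?N)"
      by (simp cong: sets_PiM_cong)
    fix A :: "nat \<Rightarrow> real set" assume "\<And>i. i \<in> {..<p} \<Longrightarrow> A i \<in> sets (?N i)"
    then have A [measurable]: "A i \<in> sets borel" if "i < p" for i using that by simp
    have box: "Pi\<^sub>E {..<p} A \<in> sets (\<Pi>\<^sub>M i\<in>{..<p}. lborel)"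
      by (rule sets_PiM_I_finite) auto
    have "emeasure (density (\<Pi>\<^sub>M i\<in>{..<p}. lborel)
        (\<lambda>x. ennreal (\<Prod>i<p. normal_density (\<mu> i) s (x i)))) (Pi\<^sub>E {..<p} A)
      = (\<integral>\<^sup>+x. ennreal (\<Prod>i<p. normal_density (\<mu> i) s (x i)) * indicator (Pi\<^sub>E {..<p} A) x
           \<partial>(\<Pi>\<^sub>M i\<in>{..<p}. lborel))"
      using box by (subst emeasure_density) auto
    also have "\<dots> = (\<integral>\<^sup>+x. (\<Prod>i<p. ennreal (normal_density (\<mu> i) s (x i)) * indicator (A i) (x i))
           \<partial>(\<Pi>\<^sub>M i\<in>{..<p}. lborel))"
    proof (rule nn_integral_cong)
      fix x assume x: "x \<in> space (\<Pi>\<^sub>M i\<in>{..<p}. lborel :: real measure)"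
      have "indicator (Pi\<^sub>E {..<p} A) x = (\<Prod>i<p. indicator (A i) (x i) :: ennreal)"
      proof (cases "x \<in> Pi\<^sub>E {..<p} A")
        case False
        then obtain i where "i < p" "x i \<notin> A i"
          using x by (auto simp: space_PiM PiE_iff)
        then have "(\<Prod>i<p. indicator (A i) (x i) :: ennreal) = 0"
          by (intro prod_zero bexI[of _ i]) auto
        with False show ?thesis by simp
      qed (auto simp: PiE_iff)
      then show "ennreal (\<Prod>i<p. normal_density (\<mu> i) s (x i)) * indicator (Pi\<^sub>E {..<p} A) x
          = (\<Prod>i<p. ennreal (normal_density (\<mu> i) s (x i)) * indicator (A i) (x i))"
        by (simp add: prod.distrib prod_ennreal)
    qed
    also have "\<dots> = (\<Prod>i<p. emeasure (?N i) (A i))"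
      by (subst L.product_nn_integral_prod) (auto intro!: prod.cong simp: emeasure_density)
    finally show "emeasure (density (\<Pi>\<^sub>M i\<in>{..<p}. lborel)
        (\<lambda>x. ennreal (\<Prod>i<p. normal_density (\<mu> i) s (x i)))) (Pi\<^sub>E {..<p} A)
        = (\<Prod>i\<in>{..<p}. emeasure (?N i) (A i))" .
  qed simp
qed

lemma nn_integral_normal_vec:
  assumes "0 < s" and [measurable]: "f \<in> borel_measurable (\<Pi>\<^sub>M i\<in>{..<p}. lborel)"
  shows "(\<integral>\<^sup>+x. f x \<partial>normal_vec p \<mu> s) =
    (\<integral>\<^sup>+x. ennreal (\<Prod>i<p. normal_density (\<mu> i) s (x i)) * f x \<partial>(\<Pi>\<^sub>M i\<in>{..<p}. lborel))"
  unfolding normal_vec_eq_density[OF assms(1)] by (rule nn_integral_density) auto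

section \<open>Exchanging prior and posterior\<close>

text \<open>
  Completing the square in \<open>\<theta>\<close>: the joint density of parameter and observation is the marginal
  density of the observation times the posterior density of the parameter.
\<close>

lemma normal_density_prior_posterior:
  assumes s: "0 < \<sigma>" and t: "0 < \<tau>"
  shows "normal_density \<theta> \<sigma> x * normal_density \<nu> \<tau> \<theta> =
    normal_density \<nu> (sqrt (\<sigma>\<^sup>2 + \<tau>\<^sup>2)) x *
    normal_density (\<nu> + \<tau>\<^sup>2 / (\<sigma>\<^sup>2 + \<tau>\<^sup>2) * (x - \<nu>)) (\<sigma> * \<tau> / sqrt (\<sigma>\<^sup>2 + \<tau>\<^sup>2)) \<theta>"
proof -
  define V where "V = \<sigma>\<^sup>2 + \<tau>\<^sup>2"
  have V: "0 < V" using s by (simp add: V_def add_pos_nonneg)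
  define m where "m = \<nu> + \<tau>\<^sup>2 / V * (x - \<nu>)"
  have ss: "(sqrt V)\<^sup>2 = V" and rr: "(\<sigma> * \<tau> / sqrt V)\<^sup>2 = \<sigma>\<^sup>2 * \<tau>\<^sup>2 / V"
    using V by (simp_all add: power_mult_distrib power_divide)
  have "- (x - \<theta>)\<^sup>2 / (2 * \<sigma>\<^sup>2) + - (\<theta> - \<nu>)\<^sup>2 / (2 * \<tau>\<^sup>2)
      = - (x - \<nu>)\<^sup>2 / (2 * V) + - (\<theta> - m)\<^sup>2 / (2 * (\<sigma>\<^sup>2 * \<tau>\<^sup>2 / V))"
  proof -
    \<comment> \<open>The exponents, multiplied by \<open>- 2 \<sigma>\<^sup>2 \<tau>\<^sup>2 V\<close>.\<close>
    have "(x - \<theta>)\<^sup>2 * \<tau>\<^sup>2 * V + (\<theta> - \<nu>)\<^sup>2 * \<sigma>\<^sup>2 * V = (x - \<nu>)\<^sup>2 * \<sigma>\<^sup>2 * \<tau>\<^sup>2 + (V * (\<theta> - m))\<^sup>2"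
    proof -
      have "V * (\<theta> - m) = V * (\<theta> - \<nu>) - \<tau>\<^sup>2 * (x - \<nu>)"
        using V by (simp add: m_def field_simps)
      then show ?thesis unfolding V_def by algebra
    qed
    then show ?thesis using s t V
      by (simp add: divide_simps power_mult_distrib) algebra
  qed
  moreover have "1 / sqrt (2 * pi * \<sigma>\<^sup>2) * (1 / sqrt (2 * pi * \<tau>\<^sup>2))
      = 1 / sqrt (2 * pi * V) * (1 / sqrt (2 * pi * (\<sigma>\<^sup>2 * \<tau>\<^sup>2 / V)))"
    using V by (simp add: real_sqrt_mult[symmetric] field_simps)
  ultimately show ?thesis
    unfolding V_def[symmetric] m_def[symmetric]
    unfolding normal_density_def ss rr
    by (simp add: exp_add[symmetric] mult.assoc mult.left_commute)
qed

text \<open>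
  Bayes' theorem for the normal location model as an exchange of the order of integration. It holds
  because the densities satisfy \<open>normal_density_prior_posterior\<close> in each coordinate.
\<close>

lemma nn_integral_prior_posterior_swap:
  assumes s: "0 < \<sigma>" and t: "0 < \<tau>"
    and [measurable]: "case_prod f \<in> borel_measurable
      ((\<Pi>\<^sub>M i\<in>{..<p}. lborel) \<Otimes>\<^sub>M (\<Pi>\<^sub>M i\<in>{..<p}. lborel))"
  shows "(\<integral>\<^sup>+\<theta>. \<integral>\<^sup>+x. f x \<theta> \<partial>normal_vec p \<theta> \<sigma> \<partial>normal_vec p \<nu> \<tau>) =
    (\<integral>\<^sup>+x. \<integral>\<^sup>+\<theta>. f x \<theta>
        \<partial>normal_vec p (\<lambda>i. \<nu> i + \<tau>\<^sup>2 / (\<sigma>\<^sup>2 + \<tau>\<^sup>2) * (x i - \<nu> i)) (\<sigma> * \<tau> / sqrt (\<sigma>\<^sup>2 + \<tau>\<^sup>2))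
        \<partial>normal_vec p \<nu> (sqrt (\<sigma>\<^sup>2 + \<tau>\<^sup>2)))"
proof -
  let ?L = "\<Pi>\<^sub>M i\<in>{..<p}. lborel :: real measure"
  interpret product_sigma_finite "\<lambda>_::nat. lborel :: real measure" ..
  interpret finite_product_sigma_finite "\<lambda>_::nat. lborel :: real measure" "{..<p}" by standard simp
  interpret LL: pair_sigma_finite ?L ?L ..
  define \<rho> where "\<rho> = \<sigma> * \<tau> / sqrt (\<sigma>\<^sup>2 + \<tau>\<^sup>2)"
  define v where "v = sqrt (\<sigma>\<^sup>2 + \<tau>\<^sup>2)"
  have pos: "0 < v" "0 < \<rho>" using s t by (simp_all add: v_def \<rho>_def add_pos_nonneg)
  define m where "m x i = \<nu> i + \<tau>\<^sup>2 / (\<sigma>\<^sup>2 + \<tau>\<^sup>2) * (x i - \<nu> i)" for x i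
  define g where "g \<mu> r x = (\<Prod>i<p. normal_density (\<mu> i) r (x i))" for \<mu> r and x :: "nat \<Rightarrow> real"
  have [measurable (raw)]: "(\<lambda>w. g (a w) r (b w)) \<in> borel_measurable M"
    if "\<And>i. i < p \<Longrightarrow> (\<lambda>w. a w i) \<in> borel_measurable M"
       "\<And>i. i < p \<Longrightarrow> (\<lambda>w. b w i) \<in> borel_measurable M" for a b r and M :: "'z measure"
    unfolding g_def using that by measurable
  have gm [measurable]: "(\<lambda>(x, \<theta>). g \<theta> r x) \<in> borel_measurable (?L \<Otimes>\<^sub>M ?L)"
      "(\<lambda>(x, \<theta>). g (m x) r \<theta>) \<in> borel_measurable (?L \<Otimes>\<^sub>M ?L)" "g \<nu> r \<in> borel_measurable ?L" for r
    unfolding g_def m_def by measurable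
  have g0: "0 \<le> g \<mu> r x" for \<mu> r x by (simp add: g_def prod_nonneg)
  have key: "g \<theta> \<sigma> x * g \<nu> \<tau> \<theta> = g \<nu> v x * g (m x) \<rho> \<theta>" for x \<theta>
    unfolding g_def prod.distrib[symmetric] m_def v_def \<rho>_def
    by (intro prod.cong refl normal_density_prior_posterior s t)
  have keyE: "ennreal (g \<nu> \<tau> \<theta>) * (ennreal (g \<theta> \<sigma> x) * c)
      = ennreal (g \<nu> v x) * (ennreal (g (m x) \<rho> \<theta>) * c)" for x \<theta> c
  proof -
    have "ennreal (g \<nu> \<tau> \<theta>) * ennreal (g \<theta> \<sigma> x) = ennreal (g \<nu> v x) * ennreal (g (m x) \<rho> \<theta>)"
      unfolding ennreal_mult[OF g0 g0, symmetric] using key[of \<theta> x] by (simp only: mult.commute)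
    then show ?thesis by (simp only: mult.assoc[symmetric])
  qed
  have sp: "space (normal_vec p \<mu> r) = space ?L" for \<mu> r
    by (rule sets_eq_imp_space_eq) (rule sets_normal_vec)
  have iter: "(\<integral>\<^sup>+y. \<integral>\<^sup>+z. h z y \<partial>normal_vec p (b y) r \<partial>normal_vec p \<nu> r')
      = (\<integral>\<^sup>+y. ennreal (g \<nu> r' y) * (\<integral>\<^sup>+z. ennreal (g (b y) r z) * h z y \<partial>?L) \<partial>?L)"
    if [measurable]: "case_prod h \<in> borel_measurable (?L \<Otimes>\<^sub>M ?L)"
      "(\<lambda>(y, z). g (b y) r z) \<in> borel_measurable (?L \<Otimes>\<^sub>M ?L)"
      and r: "0 < r" "0 < r'" for h :: "(nat \<Rightarrow> real) \<Rightarrow> (nat \<Rightarrow> real) \<Rightarrow> ennreal" and b r r'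
  proof -
    have "(\<integral>\<^sup>+y. \<integral>\<^sup>+z. h z y \<partial>normal_vec p (b y) r \<partial>normal_vec p \<nu> r')
      = (\<integral>\<^sup>+y. \<integral>\<^sup>+z. ennreal (g (b y) r z) * h z y \<partial>?L \<partial>normal_vec p \<nu> r')"
      unfolding g_def
      by (intro nn_integral_cong nn_integral_normal_vec r) (simp add: sp)
    also have "\<dots> = (\<integral>\<^sup>+y. ennreal (g \<nu> r' y) * (\<integral>\<^sup>+z. ennreal (g (b y) r z) * h z y \<partial>?L) \<partial>?L)"
      using that(2) r unfolding g_def
      by (intro nn_integral_normal_vec) simp_all
    finally show ?thesis .
  qed
  have "(\<integral>\<^sup>+\<theta>. \<integral>\<^sup>+x. f x \<theta> \<partial>normal_vec p \<theta> \<sigma> \<partial>normal_vec p \<nu> \<tau>)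
      = (\<integral>\<^sup>+\<theta>. ennreal (g \<nu> \<tau> \<theta>) * (\<integral>\<^sup>+x. ennreal (g \<theta> \<sigma> x) * f x \<theta> \<partial>?L) \<partial>?L)"
    using s t by (intro iter) simp_all
  also have "\<dots> = (\<integral>\<^sup>+\<theta>. \<integral>\<^sup>+x. ennreal (g \<nu> \<tau> \<theta>) * (ennreal (g \<theta> \<sigma> x) * f x \<theta>) \<partial>?L \<partial>?L)"
    by (intro nn_integral_cong nn_integral_cmult[symmetric]) measurable
  also have "\<dots> = (\<integral>\<^sup>+\<theta>. \<integral>\<^sup>+x. ennreal (g \<nu> v x) * (ennreal (g (m x) \<rho> \<theta>) * f x \<theta>) \<partial>?L \<partial>?L)"
    by (simp only: keyE)
  also have "\<dots> = (\<integral>\<^sup>+x. \<integral>\<^sup>+\<theta>. ennreal (g \<nu> v x) * (ennreal (g (m x) \<rho> \<theta>) * f x \<theta>) \<partial>?L \<partial>?L)"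
    by (rule LL.Fubini') measurable
  also have "\<dots> = (\<integral>\<^sup>+x. ennreal (g \<nu> v x) * (\<integral>\<^sup>+\<theta>. ennreal (g (m x) \<rho> \<theta>) * f x \<theta> \<partial>?L) \<partial>?L)"
    by (intro nn_integral_cong nn_integral_cmult) measurable
  also have "\<dots> = (\<integral>\<^sup>+x. \<integral>\<^sup>+\<theta>. f x \<theta> \<partial>normal_vec p (m x) \<rho> \<partial>normal_vec p \<nu> v)"
    using pos by (intro iter[symmetric]) simp_all
  finally show ?thesis by (simp add: m_def[abs_def] \<rho>_def v_def)
qed

section \<open>Second moments of normal vectors and chi-square moments\<close>

lemma nn_integral_normal_vec_component:
  assumes s: "0 < s" and i: "i < p" and [measurable]: "f \<in> borel_measurable borel"
  shows "(\<integral>\<^sup>+x. f (x i) \<partial>normal_vec p \<mu> s) = (\<integral>\<^sup>+z. ennreal (normal_density (\<mu> i) s z) * f z \<partial>lborel)"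
proof -
  let ?N = "\<lambda>i. density lborel (\<lambda>x. ennreal (normal_density (\<mu> i) s x))"
  have "(\<integral>\<^sup>+z. ennreal (normal_density (\<mu> i) s z) * f z \<partial>lborel) = (\<integral>\<^sup>+z. f z \<partial>?N i)"
    by (subst nn_integral_density) auto
  also have "\<dots> = (\<integral>\<^sup>+z. f z \<partial>distr (PiM {..<p} ?N) (?N i) (\<lambda>x. x i))"
    using i s by (subst distr_PiM_component) (auto intro: prob_space_normal_density)
  also have "\<dots> = (\<integral>\<^sup>+x. f (x i) \<partial>normal_vec p \<mu> s)"
    using i unfolding normal_vec_def by (subst nn_integral_distr) auto
  finally show ?thesis by simp
qed

text \<open>
  The bias-variance decomposition, from expanding \<open>z - a = (z - \<mu>) + (\<mu> - a)\<close>; the cross term is a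
  first central moment.
\<close>

lemma nn_integral_normal_density_sq_diff:
  assumes s: "0 < s"
  shows "(\<integral>\<^sup>+z. ennreal (normal_density \<mu> s z) * ennreal ((z - a)\<^sup>2) \<partial>lborel) = ennreal (s\<^sup>2 + (\<mu> - a)\<^sup>2)"
proof -
  have "has_bochner_integral lborel
      (\<lambda>z. normal_density \<mu> s z * (z - \<mu>)^(2*1) + normal_density \<mu> s z * (z - \<mu>)^(2*0+1) * (2 * (\<mu> - a))
         + normal_density \<mu> s z * (z - \<mu>)^(2*0) * (\<mu> - a)\<^sup>2)
      (fact (2*1) / ((2 / s\<^sup>2)^1 * fact 1) + 0 * (2 * (\<mu> - a)) + fact (2*0) / ((2 / s\<^sup>2)^0 * fact 0) * (\<mu> - a)\<^sup>2)"
    by (intro has_bochner_integral_add has_bochner_integral_mult_left normal_moment_even normal_moment_odd s)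
  also have "(fact (2*1) / ((2 / s\<^sup>2)^1 * fact 1) + 0 * (2 * (\<mu> - a)) + fact (2*0) / ((2 / s\<^sup>2)^0 * fact 0) * (\<mu> - a)\<^sup>2)
      = s\<^sup>2 + (\<mu> - a)\<^sup>2" by simp
  also have "(\<lambda>z. normal_density \<mu> s z * (z - \<mu>)^(2*1) + normal_density \<mu> s z * (z - \<mu>)^(2*0+1) * (2 * (\<mu> - a))
         + normal_density \<mu> s z * (z - \<mu>)^(2*0) * (\<mu> - a)\<^sup>2) = (\<lambda>z. normal_density \<mu> s z * (z - a)\<^sup>2)"
    by (simp add: fun_eq_iff power2_eq_square algebra_simps)
  finally have "has_bochner_integral lborel (\<lambda>z. normal_density \<mu> s z * (z - a)\<^sup>2) (s\<^sup>2 + (\<mu> - a)\<^sup>2)" .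
  then have "(\<integral>\<^sup>+z. ennreal (normal_density \<mu> s z * (z - a)\<^sup>2) \<partial>lborel) = ennreal (s\<^sup>2 + (\<mu> - a)\<^sup>2)"
    by (subst nn_integral_eq_integral) (auto simp: has_bochner_integral_iff)
  then show ?thesis by (simp add: ennreal_mult)
qed

lemma nn_integral_normal_vec_sq_norm_diff:
  assumes s: "0 < s"
  shows "(\<integral>\<^sup>+x. ennreal (sq_norm p (\<lambda>i. x i - a i)) \<partial>normal_vec p \<mu> s) =
    ennreal (real p * s\<^sup>2 + sq_norm p (\<lambda>i. \<mu> i - a i))"
proof -
  have "(\<integral>\<^sup>+x. ennreal (sq_norm p (\<lambda>i. x i - a i)) \<partial>normal_vec p \<mu> s) =
      (\<Sum>i<p. \<integral>\<^sup>+x. ennreal ((x i - a i)\<^sup>2) \<partial>normal_vec p \<mu> s)"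
    unfolding sq_norm_def by (subst nn_integral_sum[symmetric]) (auto simp: sum_ennreal)
  also have "\<dots> = (\<Sum>i<p. ennreal (s\<^sup>2 + (\<mu> i - a i)\<^sup>2))"
  proof (rule sum.cong)
    fix i assume "i \<in> {..<p}"
    then show "(\<integral>\<^sup>+x. ennreal ((x i - a i)\<^sup>2) \<partial>normal_vec p \<mu> s) = ennreal (s\<^sup>2 + (\<mu> i - a i)\<^sup>2)"
      using nn_integral_normal_vec_component[OF s, of i p "\<lambda>z. ennreal ((z - a i)\<^sup>2)" \<mu>] s
      by (simp add: nn_integral_normal_density_sq_diff)
  qed simp
  also have "\<dots> = ennreal (real p * s\<^sup>2 + sq_norm p (\<lambda>i. \<mu> i - a i))"
    by (simp add: sum_ennreal sum.distrib sq_norm_def del: ennreal_plus)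
  finally show ?thesis .
qed

text \<open>
  For the second moment, adding an independent standard normal coordinate \<open>Z\<close> to a sum \<open>Q\<close> of \<open>n\<close> squares
  gives \<open>E (Q + Z\<^sup>2)\<^sup>2 = E Q\<^sup>2 + 2 n + 3\<close>, since \<open>E Z\<^sup>4 = 3\<close>; so the second moment is \<open>n (n + 2)\<close> by
  induction.
\<close>

lemma chi_square_moments:
  "(\<integral>\<^sup>+u. ennreal u \<partial>chi_square n) = ennreal (real n)"
  "(\<integral>\<^sup>+u. ennreal (u\<^sup>2) \<partial>chi_square n) = ennreal (real n * (real n + 2))"
proof -
  have m [measurable]: "sq_norm n \<in> borel_measurable (\<Pi>\<^sub>M i\<in>{..<n}. lborel)" for n
    by measurable
  have first: "(\<integral>\<^sup>+x. ennreal (sq_norm n x) \<partial>normal_vec n (\<lambda>_. 0) 1) = ennreal (real n)" for n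
    using nn_integral_normal_vec_sq_norm_diff[of 1 n "\<lambda>_. 0" "\<lambda>_. 0"] by (simp add: sq_norm_def)
  show "(\<integral>\<^sup>+u. ennreal u \<partial>chi_square n) = ennreal (real n)"
    unfolding chi_square_def by (subst nn_integral_distr) (auto simp: first)
  let ?N = "density lborel (\<lambda>x. ennreal (std_normal_density x))"
  interpret N: prob_space ?N by (rule prob_space_normal_density) simp
  have sets_N: "sets (\<Pi>\<^sub>M i\<in>I. ?N) = sets (\<Pi>\<^sub>M i\<in>I. lborel)" for I :: "nat set"
    by (intro sets_PiM_cong) auto
  interpret P: product_sigma_finite "\<lambda>_::nat. ?N" ..
  have N2: "(\<integral>\<^sup>+z. ennreal (z\<^sup>2) \<partial>?N) = 1"
    using nn_integral_normal_density_sq_diff[of 1 0 0]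
    by (subst nn_integral_density) auto
  have N4: "(\<integral>\<^sup>+z. ennreal (z^4) \<partial>?N) = 3"
  proof -
    have "(\<integral>\<^sup>+z. ennreal (std_normal_density z * z^4) \<partial>lborel) = ennreal 3"
      using std_normal_moment_even[of 2]
      by (subst nn_integral_eq_integral) (auto simp: has_bochner_integral_iff fact_numeral)
    then show ?thesis by (subst nn_integral_density) (auto simp: ennreal_mult)
  qed
  have second: "(\<integral>\<^sup>+x. ennreal ((sq_norm n x)\<^sup>2) \<partial>normal_vec n (\<lambda>_. 0) 1) = ennreal (real n * (real n + 2))"
  proof (induction n)
    case 0
    show ?case by (simp add: sq_norm_def)
  next
    case (Suc n)
    let ?P = "normal_vec n (\<lambda>_. 0) 1"
    interpret Q: prob_space ?P by (rule prob_space_normal_vec) simp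
    have "(\<integral>\<^sup>+x. ennreal ((sq_norm (Suc n) x)\<^sup>2) \<partial>normal_vec (Suc n) (\<lambda>_. 0) 1)
        = (\<integral>\<^sup>+x. \<integral>\<^sup>+z. ennreal ((sq_norm n x + z\<^sup>2)\<^sup>2) \<partial>?N \<partial>?P)"
      unfolding normal_vec_def lessThan_Suc
      by (subst P.product_nn_integral_insert)
         (auto simp: sq_norm_def measurable_cong_sets[OF sets_N refl] lessThan_Suc[symmetric]
           intro!: nn_integral_cong arg_cong[where f=ennreal] arg_cong[where f="\<lambda>x. x\<^sup>2"] sum.cong)
    also have "\<dots> = (\<integral>\<^sup>+x. ennreal ((sq_norm n x)\<^sup>2) + ennreal (2 * sq_norm n x) + 3 \<partial>?P)"
    proof (rule nn_integral_cong)
      fix x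
      have "(\<integral>\<^sup>+z. ennreal ((sq_norm n x + z\<^sup>2)\<^sup>2) \<partial>?N)
          = (\<integral>\<^sup>+z. ennreal ((sq_norm n x)\<^sup>2) + ennreal (2 * sq_norm n x) * ennreal (z\<^sup>2) + ennreal (z^4) \<partial>?N)"
        by (intro nn_integral_cong)
           (simp add: ennreal_mult[symmetric] ennreal_plus[symmetric] power2_sum power_mult[symmetric]
             mult_ac add_ac del: ennreal_plus)
      also have "\<dots> = ennreal ((sq_norm n x)\<^sup>2) + ennreal (2 * sq_norm n x) + 3"
        using N2 N4 N.emeasure_space_1
        by (simp add: nn_integral_add nn_integral_cmult)
      finally show "(\<integral>\<^sup>+z. ennreal ((sq_norm n x + z\<^sup>2)\<^sup>2) \<partial>?N)
          = ennreal ((sq_norm n x)\<^sup>2) + ennreal (2 * sq_norm n x) + 3" .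
    qed
    also have "\<dots> = ennreal (real n * (real n + 2)) + ennreal 2 * ennreal (real n) + 3"
      using Q.emeasure_space_1
      by (simp add: nn_integral_add Suc.IH ennreal_mult nn_integral_cmult first)
    also have "\<dots> = ennreal (real (Suc n) * (real (Suc n) + 2))"
    proof -
      have "(3::ennreal) = ennreal 3" by simp
      then show ?thesis
        by (simp only: ennreal_mult[symmetric] ennreal_plus[symmetric] of_nat_0_le_iff
            add_nonneg_nonneg mult_nonneg_nonneg zero_le_numeral) (simp add: algebra_simps)
    qed
    finally show ?case .
  qed
  show "(\<integral>\<^sup>+u. ennreal (u\<^sup>2) \<partial>chi_square n) = ennreal (real n * (real n + 2))"
    unfolding chi_square_def by (subst nn_integral_distr) (auto simp: second)
qed

section \<open>The inverse moment of the squared norm\<close>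

text \<open>
  The value is infinite for \<open>q = 0\<close>, in contrast to the real convention \<open>1 / 0 = 0\<close>. Hence a finite
  inverse moment also shows that the squared norm is almost surely positive.
\<close>

lemma nn_integral_exp_half_line:
  assumes "0 \<le> q"
  shows "(\<integral>\<^sup>+t. ennreal (exp (- t * q)) * indicator {0..} t \<partial>lborel) = inverse (ennreal q)"
proof (cases "q = 0")
  case True
  have "emeasure lborel {0::real..} = top"
  proof (rule ccontr)
    assume "emeasure lborel {0::real..} \<noteq> top"
    then obtain n :: nat where n: "emeasure lborel {0::real..} < of_nat n"
      using ennreal_Ex_less_of_nat by (auto simp: less_top)
    have "emeasure lborel {0..real n} \<le> emeasure lborel {0::real..}"
      by (rule emeasure_mono) auto
    with n show False by (simp add: ennreal_of_nat_eq_real_of_nat)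
  qed
  with True show ?thesis by simp
next
  case False
  then have q: "0 < q" using assms by simp
  have "(\<integral>\<^sup>+t. ennreal (exp (- t * q)) * indicator {0..} t \<partial>lborel) = ennreal (0 - (- exp (- 0 * q) / q))"
  proof (rule nn_integral_FTC_atLeast)
    show "((\<lambda>t. - exp (- t * q) / q) \<longlongrightarrow> 0) at_top"
      using q by real_asymp
  qed (use q in \<open>auto intro!: derivative_eq_intros\<close>)
  then show ?thesis using q by (simp add: inverse_ennreal inverse_eq_divide)
qed

text \<open>
  The Gaussian factor \<open>exp (- t (z - \<mu>)\<^sup>2)\<close> turns the density into a multiple of the normal density
  with variance \<open>s\<^sup>2 / (1 + 2 t s\<^sup>2)\<close>.
\<close>

lemma nn_integral_normal_density_exp_sq:
  assumes s: "0 < s" and t: "0 \<le> t"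
  shows "(\<integral>\<^sup>+z. ennreal (normal_density \<mu> s z) * ennreal (exp (- t * (z - \<mu>)\<^sup>2)) \<partial>lborel)
    = ennreal (1 / sqrt (1 + 2 * t * s\<^sup>2))"
proof -
  define d where "d = 1 + 2 * t * s\<^sup>2"
  have d: "0 < d" using s t by (simp add: d_def add_pos_nonneg)
  have "normal_density \<mu> s z * exp (- t * (z - \<mu>)\<^sup>2) = 1 / sqrt d * normal_density \<mu> (s / sqrt d) z" for z
  proof -
    have "- (z - \<mu>)\<^sup>2 / (2 * s\<^sup>2) + - t * (z - \<mu>)\<^sup>2 = - (z - \<mu>)\<^sup>2 / (2 * (s\<^sup>2 / d))"
      using s d by (simp add: field_simps) (simp add: d_def algebra_simps)
    moreover have "1 / sqrt (2 * pi * s\<^sup>2) = 1 / sqrt d * (1 / sqrt (2 * pi * (s\<^sup>2 / d)))"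
      using d by (simp add: real_sqrt_mult real_sqrt_divide)
    moreover have "(s / sqrt d)\<^sup>2 = s\<^sup>2 / d" using d by (simp add: power_divide)
    ultimately show ?thesis
      unfolding normal_density_def by (simp add: exp_add[symmetric])
  qed
  then have "(\<integral>\<^sup>+z. ennreal (normal_density \<mu> s z) * ennreal (exp (- t * (z - \<mu>)\<^sup>2)) \<partial>lborel)
      = (\<integral>\<^sup>+z. ennreal (1 / sqrt d) * ennreal (normal_density \<mu> (s / sqrt d) z) \<partial>lborel)"
    using d by (simp add: ennreal_mult[symmetric])
  also have "\<dots> = ennreal (1 / sqrt d)"
    using s d by (subst nn_integral_cmult) (auto simp: nn_integral_eq_integral)
  finally show ?thesis by (simp add: d_def)
qed

text \<open>
  Writing \<open>1 / q\<close> as the integral of \<open>exp (- t q)\<close> over \<open>t \<ge> 0\<close> and exchanging integrals leaves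
  the integral of the Laplace transform of the squared norm, a product of one-dimensional ones.
  It decays like \<open>t powr (- p / 2)\<close>, which is integrable at infinity just for \<open>p \<ge> 3\<close>.
\<close>

lemma nn_integral_normal_vec_inverse_sq_norm:
  assumes s: "0 < s" and p: "3 \<le> p"
  shows "(\<integral>\<^sup>+x. inverse (ennreal (sq_norm p (\<lambda>i. x i - \<mu> i))) \<partial>normal_vec p \<mu> s)
    = ennreal (1 / ((real p - 2) * s\<^sup>2))"
proof -
  let ?P = "normal_vec p \<mu> s"
  let ?N = "\<lambda>i. density lborel (\<lambda>x. ennreal (normal_density (\<mu> i) s x))"
  interpret P: prob_space ?P by (rule prob_space_normal_vec) fact
  interpret N: product_sigma_finite ?N
    by (intro product_sigma_finite.intro prob_space_imp_sigma_finite prob_space_normal_density s)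
  interpret PL: pair_sigma_finite ?P lborel ..
  have laplace: "(\<integral>\<^sup>+x. ennreal (exp (- t * sq_norm p (\<lambda>i. x i - \<mu> i))) \<partial>?P)
      = ennreal ((1 + 2 * t * s\<^sup>2) powr (- real p / 2))" if t: "0 \<le> t" for t
  proof -
    have d: "0 < 1 + 2 * t * s\<^sup>2" using s t by (simp add: add_pos_nonneg)
    have "(\<integral>\<^sup>+x. ennreal (exp (- t * sq_norm p (\<lambda>i. x i - \<mu> i))) \<partial>?P)
        = (\<integral>\<^sup>+x. (\<Prod>i<p. ennreal (exp (- t * (x i - \<mu> i)\<^sup>2))) \<partial>?P)"
      by (simp add: prod_ennreal exp_sum[symmetric] sq_norm_def sum_distrib_left sum_negf)
    also have "\<dots> = (\<Prod>i<p. \<integral>\<^sup>+z. ennreal (exp (- t * (z - \<mu> i)\<^sup>2)) \<partial>?N i)"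
      unfolding normal_vec_def by (rule N.product_nn_integral_prod) auto
    also have "\<dots> = (\<Prod>i<p. ennreal (1 / sqrt (1 + 2 * t * s\<^sup>2)))"
      by (intro prod.cong refl, subst nn_integral_density)
         (use nn_integral_normal_density_exp_sq[OF s t] in auto)
    also have "\<dots> = ennreal ((1 / sqrt (1 + 2 * t * s\<^sup>2)) ^ p)"
      using d by (simp add: ennreal_power)
    also have "(1 / sqrt (1 + 2 * t * s\<^sup>2)) ^ p = (1 + 2 * t * s\<^sup>2) powr (- real p / 2)"
      using d by (simp add: powr_half_sqrt[symmetric] powr_minus_divide power_one_over
          powr_realpow[symmetric] powr_powr)
    finally show ?thesis .
  qed
  have "(\<integral>\<^sup>+x. inverse (ennreal (sq_norm p (\<lambda>i. x i - \<mu> i))) \<partial>?P)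
      = (\<integral>\<^sup>+x. \<integral>\<^sup>+t. ennreal (exp (- t * sq_norm p (\<lambda>i. x i - \<mu> i))) * indicator {0..} t \<partial>lborel \<partial>?P)"
    by (subst nn_integral_exp_half_line) auto
  also have "\<dots> = (\<integral>\<^sup>+t. \<integral>\<^sup>+x. ennreal (exp (- t * sq_norm p (\<lambda>i. x i - \<mu> i))) * indicator {0..} t \<partial>?P \<partial>lborel)"
    by (rule PL.Fubini'[symmetric]) measurable
  also have "\<dots> = (\<integral>\<^sup>+t. ennreal ((1 + 2 * t * s\<^sup>2) powr (- real p / 2)) * indicator {0..} t \<partial>lborel)"
    by (intro nn_integral_cong) (auto simp: laplace[simplified] split: split_indicator)
  also have "\<dots> = ennreal (0 - (- ((1 + 2 * 0 * s\<^sup>2) powr (1 - real p / 2)) / ((real p - 2) * s\<^sup>2)))"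
  proof (rule nn_integral_FTC_atLeast)
    have "((\<lambda>t. (1 + 2 * t * s\<^sup>2) powr (1 - real p / 2)) \<longlongrightarrow> 0) at_top"
    proof (rule tendsto_neg_powr)
      show "1 - real p / 2 < 0" using p by simp
      show "filterlim (\<lambda>t. 1 + 2 * t * s\<^sup>2) at_top at_top" using s by real_asymp
    qed
    from tendsto_divide[OF tendsto_minus[OF this] tendsto_const, of "(real p - 2) * s\<^sup>2"]
    show "((\<lambda>t. - ((1 + 2 * t * s\<^sup>2) powr (1 - real p / 2)) / ((real p - 2) * s\<^sup>2)) \<longlongrightarrow> 0) at_top"
      using s p by simp
    fix t :: real assume t: "0 \<le> t"
    have d: "0 < 1 + 2 * t * s\<^sup>2" using s t by (simp add: add_pos_nonneg)
    show "((\<lambda>t. - ((1 + 2 * t * s\<^sup>2) powr (1 - real p / 2)) / ((real p - 2) * s\<^sup>2))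
        has_real_derivative (1 + 2 * t * s\<^sup>2) powr (- real p / 2)) (at t)"
    proof -
      have "((\<lambda>t. 1 + 2 * t * s\<^sup>2) has_real_derivative 2 * s\<^sup>2) (at t)"
        by (auto intro!: derivative_eq_intros)
      from DERIV_cdivide[OF DERIV_minus[OF DERIV_fun_powr[OF this d, of "1 - real p / 2"]],
          of "(real p - 2) * s\<^sup>2"]
      show ?thesis
      proof (rule DERIV_cong)
        have "1 - real p / 2 - of_nat 1 = - real p / 2" "2 * (1 - real p / 2) = - (real p - 2)"
          by simp_all
        then show "- ((1 - real p / 2) * (1 + 2 * t * s\<^sup>2) powr (1 - real p / 2 - of_nat 1) * (2 * s\<^sup>2))
            / ((real p - 2) * s\<^sup>2) = (1 + 2 * t * s\<^sup>2) powr (- real p / 2)"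
          using s p by (simp add: divide_simps) (simp add: algebra_simps)
      qed
    qed
  qed auto
  finally show ?thesis by simp
qed

section \<open>Bayes risks\<close>

lemma sq_norm_diff_commute: "sq_norm p (\<lambda>i. x i - y i) = sq_norm p (\<lambda>i. y i - x i)"
  by (simp add: sq_norm_def power2_commute)

lemma prob_space_scaled_chi_square: "prob_space (distr (chi_square n) borel (\<lambda>u. k * u))"
proof -
  have [measurable]: "sq_norm n \<in> borel_measurable (\<Pi>\<^sub>M i\<in>{..<n}. lborel)" by measurable
  have "prob_space (chi_square n)"
    unfolding chi_square_def by (intro prob_space.prob_space_distr prob_space_normal_vec) auto
  then show ?thesis
    by (rule prob_space.prob_space_distr) (simp add: chi_square_def)
qed

lemma AE_scaled_chi_square_nonneg:
  assumes "0 \<le> k"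
  shows "AE u in distr (chi_square n) borel (\<lambda>u. k * u). 0 \<le> u"
proof -
  have [measurable]: "sq_norm n \<in> borel_measurable (\<Pi>\<^sub>M i\<in>{..<n}. lborel)" by measurable
  show ?thesis
    using assms unfolding chi_square_def by (simp add: AE_distr_iff)
qed

lemma scaled_chi_square_moments:
  assumes "0 \<le> k"
  shows "(\<integral>\<^sup>+u. ennreal u \<partial>distr (chi_square n) borel (\<lambda>u. k * u)) = ennreal (real n * k)"
    and "(\<integral>\<^sup>+u. ennreal (u\<^sup>2) \<partial>distr (chi_square n) borel (\<lambda>u. k * u)) = ennreal (real n * (real n + 2) * k\<^sup>2)"
proof -
  have [measurable_cong]: "sets (chi_square n) = sets borel" by (simp add: chi_square_def)
  show "(\<integral>\<^sup>+u. ennreal u \<partial>distr (chi_square n) borel (\<lambda>u. k * u)) = ennreal (real n * k)"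
    using assms
    by (simp add: nn_integral_distr ennreal_mult' nn_integral_cmult chi_square_moments
        mult.commute[of "real n" k])
  show "(\<integral>\<^sup>+u. ennreal (u\<^sup>2) \<partial>distr (chi_square n) borel (\<lambda>u. k * u)) = ennreal (real n * (real n + 2) * k\<^sup>2)"
  proof -
    have "(\<integral>\<^sup>+u. ennreal (u\<^sup>2) \<partial>distr (chi_square n) borel (\<lambda>u. k * u))
        = (\<integral>\<^sup>+u. ennreal (k\<^sup>2) * ennreal (u\<^sup>2) \<partial>chi_square n)"
      by (subst nn_integral_distr) (simp_all add: power_mult_distrib ennreal_mult)
    also have "\<dots> = ennreal (k\<^sup>2) * ennreal (real n * (real n + 2))"
      by (subst nn_integral_cmult) (simp_all only: chi_square_moments, measurable)
    also have "\<dots> = ennreal (real n * (real n + 2) * k\<^sup>2)"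
      by (simp only: ennreal_mult'[symmetric] zero_le_power2 mult.commute)
    finally show ?thesis .
  qed
qed

text \<open>
  Conditionally on the data the parameter has its posterior law, under which the mean squared distance
  to a fixed point is the posterior variance plus the squared distance of that point to the
  posterior mean.
\<close>

lemma bayes_risk_eq_posterior:
  fixes \<delta> :: estimator
  assumes s: "0 < \<sigma>" and t: "0 < \<tau>"
    and \<delta> [measurable]: "\<And>i. i < p \<Longrightarrow>
      (\<lambda>(x, u). \<delta> x u i) \<in> borel_measurable ((\<Pi>\<^sub>M i\<in>{..<p}. lborel) \<Otimes>\<^sub>M borel)"
  shows "bayes_risk p n \<nu> \<tau> \<sigma> \<delta> =
    (\<integral>\<^sup>+x. \<integral>\<^sup>+u. ennreal (real p * (\<sigma>\<^sup>2 * \<tau>\<^sup>2 / (\<sigma>\<^sup>2 + \<tau>\<^sup>2)) +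
          sq_norm p (\<lambda>i. \<delta> x u i - (\<nu> i + \<tau>\<^sup>2 / (\<sigma>\<^sup>2 + \<tau>\<^sup>2) * (x i - \<nu> i))))
        \<partial>distr (chi_square n) borel (\<lambda>u. \<sigma>\<^sup>2 * u) \<partial>normal_vec p \<nu> (sqrt (\<sigma>\<^sup>2 + \<tau>\<^sup>2)))"
proof -
  let ?L = "\<Pi>\<^sub>M i\<in>{..<p}. (lborel :: real measure)"
  let ?U = "distr (chi_square n) borel (\<lambda>u. \<sigma>\<^sup>2 * u)"
  let ?V = "\<sigma>\<^sup>2 + \<tau>\<^sup>2"
  define \<rho> where "\<rho> = \<sigma> * \<tau> / sqrt ?V"
  define m where "m x i = \<nu> i + \<tau>\<^sup>2 / ?V * (x i - \<nu> i)" for x i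
  have \<rho>: "0 < \<rho>" "\<rho>\<^sup>2 = \<sigma>\<^sup>2 * \<tau>\<^sup>2 / ?V"
    using s t by (auto simp: \<rho>_def add_pos_nonneg power_divide power_mult_distrib)
  interpret U: prob_space ?U by (rule prob_space_scaled_chi_square)
  have sp: "space (normal_vec p \<mu> r) = space ?L" for \<mu> r
    by (rule sets_eq_imp_space_eq) (rule sets_normal_vec)
  have loss [measurable]: "(\<lambda>((x, \<theta>), u). sq_norm p (\<lambda>i. \<delta> x u i - \<theta> i))
      \<in> borel_measurable ((?L \<Otimes>\<^sub>M ?L) \<Otimes>\<^sub>M borel)"
  proof -
    have "(\<lambda>w. \<delta> (fst (fst w)) (snd w) i - snd (fst w) i) \<in> borel_measurable ((?L \<Otimes>\<^sub>M ?L) \<Otimes>\<^sub>M borel)"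
      if "i < p" for i
    proof -
      have "(\<lambda>w. (fst (fst w), snd w)) \<in> measurable ((?L \<Otimes>\<^sub>M ?L) \<Otimes>\<^sub>M borel) (?L \<Otimes>\<^sub>M borel)"
        by measurable
      from measurable_compose[OF this \<delta>[OF that]] that show ?thesis by simp
    qed
    then show ?thesis
      unfolding case_prod_beta by (intro measurable_sq_norm)
  qed
  have loss_x [measurable]: "(\<lambda>(\<theta>, u). sq_norm p (\<lambda>i. \<delta> x u i - \<theta> i)) \<in> borel_measurable (?L \<Otimes>\<^sub>M borel)"
    if "x \<in> space ?L" for x
  proof -
    have "(\<lambda>w. ((x, fst w), snd w)) \<in> measurable (?L \<Otimes>\<^sub>M borel) ((?L \<Otimes>\<^sub>M ?L) \<Otimes>\<^sub>M borel)"
      using that by measurable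
    from measurable_compose[OF this loss] show ?thesis by (simp add: case_prod_beta)
  qed
  have loss_\<theta> [measurable]: "(\<lambda>(x, u). sq_norm p (\<lambda>i. \<delta> x u i - \<theta> i)) \<in> borel_measurable (?L \<Otimes>\<^sub>M borel)"
    if "\<theta> \<in> space ?L" for \<theta>
  proof -
    have "(\<lambda>w. ((fst w, \<theta>), snd w)) \<in> measurable (?L \<Otimes>\<^sub>M borel) ((?L \<Otimes>\<^sub>M ?L) \<Otimes>\<^sub>M borel)"
      using that by measurable
    from measurable_compose[OF this loss] show ?thesis by (simp add: case_prod_beta)
  qed
  have "bayes_risk p n \<nu> \<tau> \<sigma> \<delta> = (\<integral>\<^sup>+\<theta>. \<integral>\<^sup>+x. \<integral>\<^sup>+u. ennreal (sq_norm p (\<lambda>i. \<delta> x u i - \<theta> i)) \<partial>?U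
      \<partial>normal_vec p \<theta> \<sigma> \<partial>normal_vec p \<nu> \<tau>)"
    unfolding bayes_risk_def risk_def sample_law_def
  proof (rule nn_integral_cong)
    fix \<theta> assume "\<theta> \<in> space (normal_vec p \<nu> \<tau>)"
    then have \<theta>: "\<theta> \<in> space ?L" by (simp add: sp)
    show "(\<integral>\<^sup>+(x, u). ennreal (sq_norm p (\<lambda>i. \<delta> x u i - \<theta> i)) \<partial>(normal_vec p \<theta> \<sigma> \<Otimes>\<^sub>M ?U))
        = (\<integral>\<^sup>+x. \<integral>\<^sup>+u. ennreal (sq_norm p (\<lambda>i. \<delta> x u i - \<theta> i)) \<partial>?U \<partial>normal_vec p \<theta> \<sigma>)"
      using loss_\<theta>[OF \<theta>] by (subst U.nn_integral_fst[symmetric]) (auto simp: case_prod_beta)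
  qed
  also have "\<dots> = (\<integral>\<^sup>+x. \<integral>\<^sup>+\<theta>. \<integral>\<^sup>+u. ennreal (sq_norm p (\<lambda>i. \<delta> x u i - \<theta> i)) \<partial>?U
      \<partial>normal_vec p (m x) \<rho> \<partial>normal_vec p \<nu> (sqrt ?V))"
    unfolding m_def \<rho>_def
    by (rule nn_integral_prior_posterior_swap[OF s t]) measurable
  also have "\<dots> = (\<integral>\<^sup>+x. \<integral>\<^sup>+u. ennreal (real p * (\<sigma>\<^sup>2 * \<tau>\<^sup>2 / ?V) +
          sq_norm p (\<lambda>i. \<delta> x u i - m x i)) \<partial>?U \<partial>normal_vec p \<nu> (sqrt ?V))"
  proof (rule nn_integral_cong)
    fix x assume "x \<in> space (normal_vec p \<nu> (sqrt ?V))"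
    then have x: "x \<in> space ?L" by (simp add: sp)
    interpret M: prob_space "normal_vec p (m x) \<rho>" by (rule prob_space_normal_vec) (rule \<rho>)
    interpret MU: pair_sigma_finite "normal_vec p (m x) \<rho>" ?U ..
    have "(\<integral>\<^sup>+\<theta>. \<integral>\<^sup>+u. ennreal (sq_norm p (\<lambda>i. \<delta> x u i - \<theta> i)) \<partial>?U \<partial>normal_vec p (m x) \<rho>)
        = (\<integral>\<^sup>+u. \<integral>\<^sup>+\<theta>. ennreal (sq_norm p (\<lambda>i. \<delta> x u i - \<theta> i)) \<partial>normal_vec p (m x) \<rho> \<partial>?U)"
      using loss_x[OF x] by (intro MU.Fubini'[symmetric]) simp
    also have "\<dots> = (\<integral>\<^sup>+u. ennreal (real p * (\<sigma>\<^sup>2 * \<tau>\<^sup>2 / ?V) + sq_norm p (\<lambda>i. \<delta> x u i - m x i)) \<partial>?U)"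
      by (simp only: sq_norm_diff_commute[of p "\<delta> x _"]
          nn_integral_normal_vec_sq_norm_diff[OF \<rho>(1)] \<rho>(2))
    finally show "(\<integral>\<^sup>+\<theta>. \<integral>\<^sup>+u. ennreal (sq_norm p (\<lambda>i. \<delta> x u i - \<theta> i)) \<partial>?U \<partial>normal_vec p (m x) \<rho>)
        = (\<integral>\<^sup>+u. ennreal (real p * (\<sigma>\<^sup>2 * \<tau>\<^sup>2 / ?V) + sq_norm p (\<lambda>i. \<delta> x u i - m x i)) \<partial>?U)" .
  qed
  finally show ?thesis unfolding m_def .
qed

lemma bayes_risk_mle:
  assumes s: "0 < \<sigma>" and t: "0 < \<tau>"
  shows "bayes_risk p n \<nu> \<tau> \<sigma> mle = ennreal (real p * \<sigma>\<^sup>2)"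
proof -
  let ?U = "distr (chi_square n) borel (\<lambda>u. \<sigma>\<^sup>2 * u)"
  interpret U: prob_space ?U by (rule prob_space_scaled_chi_square)
  interpret P: prob_space "normal_vec p \<nu> \<tau>" by (rule prob_space_normal_vec) fact
  have "risk p n \<sigma> mle \<theta> = ennreal (real p * \<sigma>\<^sup>2)" for \<theta>
  proof -
    have "risk p n \<sigma> mle \<theta> = (\<integral>\<^sup>+x. \<integral>\<^sup>+u. ennreal (sq_norm p (\<lambda>i. x i - \<theta> i)) \<partial>?U \<partial>normal_vec p \<theta> \<sigma>)"
      unfolding risk_def sample_law_def mle_def
      by (subst U.nn_integral_fst[symmetric]) (auto simp: case_prod_beta)
    also have "\<dots> = ennreal (real p * \<sigma>\<^sup>2)"
      using nn_integral_normal_vec_sq_norm_diff[OF s, of p \<theta> \<theta>] U.emeasure_space_1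
      by (simp add: sq_norm_def)
    finally show ?thesis .
  qed
  then have "risk p n \<sigma> mle = (\<lambda>_. ennreal (real p * \<sigma>\<^sup>2))"
    by (rule ext)
  then show ?thesis
    unfolding bayes_risk_def using P.emeasure_space_1 by simp
qed

text \<open>
  The excess over the posterior variance is \<open>(b - c u / q)\<^sup>2 q = b\<^sup>2 q - 2 b c u + c\<^sup>2 u\<^sup>2 / q\<close>, where
  \<open>q\<close> is the squared norm of \<open>x - \<nu>\<close> and \<open>u\<close> is the value of \<open>S\<^sup>2\<close>. As the integrals are
  nonnegative, the mean \<open>K\<close> of the cross term is moved to the other side and cancelled
  at the end, when all quantities are known to be finite. The choice of \<open>c\<close> makes the last term
  contribute exactly \<open>K / 2\<close>, so that half of the reduction \<open>K\<close> remains.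
\<close>

lemma bayes_risk_emp_mod_bayes:
  assumes s: "0 < \<sigma>" and t: "0 < \<tau>" and p: "3 \<le> p"
  shows "bayes_risk p n \<nu> \<tau> \<sigma> (emp_mod_bayes p n \<nu>) =
    ennreal (real p * \<sigma>\<^sup>2 - \<sigma>^4 / (\<sigma>\<^sup>2 + \<tau>\<^sup>2) * (real n * (real p - 2) / (real n + 2)))"
proof -
  let ?L = "\<Pi>\<^sub>M i\<in>{..<p}. (lborel :: real measure)"
  let ?U = "distr (chi_square n) borel (\<lambda>u. \<sigma>\<^sup>2 * u)"
  define V where "V = \<sigma>\<^sup>2 + \<tau>\<^sup>2"
  have V: "0 < V" using s by (simp add: V_def add_pos_nonneg)
  let ?M = "normal_vec p \<nu> (sqrt V)"
  interpret U: prob_space ?U by (rule prob_space_scaled_chi_square)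
  interpret M: prob_space ?M by (rule prob_space_normal_vec) (use V in simp)
  define q where "q x = sq_norm p (\<lambda>i. x i - \<nu> i)" for x
  have q [measurable]: "q \<in> borel_measurable ?L" unfolding q_def by measurable
  have q0: "0 \<le> q x" for x by (simp add: q_def)
  define b where "b = \<sigma>\<^sup>2 / V"
  define c where "c = (real p - 2) / (real n + 2)"
  have b: "0 \<le> b" and c: "0 \<le> c" using V p by (simp_all add: b_def c_def)
  define a where "a = real p * (\<sigma>\<^sup>2 * \<tau>\<^sup>2 / V)"
  have a: "0 \<le> a" using V by (simp add: a_def)
  define F where "F x = (\<integral>\<^sup>+u. ennreal (a + (b - c * (u / q x))\<^sup>2 * q x) \<partial>?U)" for x
  define K where "K = 2 * b * c * (real n * \<sigma>\<^sup>2)"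
  define C where "C = c\<^sup>2 * (real n * (real n + 2) * \<sigma>^4)"
  have K: "0 \<le> K" and C: "0 \<le> C" using b c by (simp_all add: K_def C_def)
  have risk: "bayes_risk p n \<nu> \<tau> \<sigma> (emp_mod_bayes p n \<nu>) = (\<integral>\<^sup>+x. F x \<partial>?M)"
  proof -
    have "sq_norm p (\<lambda>i. emp_mod_bayes p n \<nu> x u i - (\<nu> i + \<tau>\<^sup>2 / V * (x i - \<nu> i)))
        = (b - c * (u / q x))\<^sup>2 * q x" for x u
    proof -
      have "1 - \<tau>\<^sup>2 / V = b" using V by (simp add: b_def field_simps) (simp add: V_def)
      then have "emp_mod_bayes p n \<nu> x u i - (\<nu> i + \<tau>\<^sup>2 / V * (x i - \<nu> i))
          = (b - c * (u / q x)) * (x i - \<nu> i)" for i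
        unfolding emp_mod_bayes_def q_def c_def by (simp add: algebra_simps flip: \<open>1 - _ = b\<close>)
      then show ?thesis
        by (simp add: sq_norm_def q_def power_mult_distrib sum_distrib_left)
    qed
    moreover have "(\<lambda>(x, u). emp_mod_bayes p n \<nu> x u i) \<in> borel_measurable (?L \<Otimes>\<^sub>M borel)"
      if "i < p" for i
    proof -
      have [measurable]: "(\<lambda>w. fst w i) \<in> borel_measurable (?L \<Otimes>\<^sub>M borel)"
        by (rule measurable_compose[OF measurable_fst]) (use that in simp)
      show ?thesis
        unfolding emp_mod_bayes_def case_prod_beta by measurable
    qed
    ultimately show ?thesis
      by (subst bayes_risk_eq_posterior[OF s t])
         (simp_all add: F_def[abs_def] a_def flip: V_def)
  qed
  have inv: "(\<integral>\<^sup>+x. inverse (ennreal (q x)) \<partial>?M) = ennreal (1 / ((real p - 2) * V))"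
    using nn_integral_normal_vec_inverse_sq_norm[of "sqrt V" p \<nu>] V p by (simp add: q_def)
  then have "AE x in ?M. inverse (ennreal (q x)) \<noteq> \<infinity>"
    by (intro nn_integral_PInf_AE) auto
  then have AE_q: "AE x in ?M. 0 < q x"
    by eventually_elim (use q0 in \<open>auto simp: less_le\<close>)
  have F: "F x + ennreal K = ennreal a + ennreal (b\<^sup>2) * ennreal (q x) + ennreal C * inverse (ennreal (q x))"
    if qx: "0 < q x" for x
  proof -
    \<comment> \<open>Without \<open>u \<ge> 0\<close> the truncation in \<open>ennreal\<close> would spoil the cancellation.\<close>
    have AE_u: "AE u in ?U. 0 \<le> u" by (rule AE_scaled_chi_square_nonneg) simp
    have "F x + ennreal K = F x + (\<integral>\<^sup>+u. ennreal (2 * b * c) * ennreal u \<partial>?U)"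
      using b c by (simp add: nn_integral_cmult scaled_chi_square_moments K_def ennreal_mult)
    also have "\<dots> = (\<integral>\<^sup>+u. ennreal (a + (b - c * (u / q x))\<^sup>2 * q x) + ennreal (2 * b * c) * ennreal u \<partial>?U)"
      unfolding F_def by (subst nn_integral_add) auto
    also have "\<dots> = (\<integral>\<^sup>+u. ennreal (a + b\<^sup>2 * q x) + ennreal (c\<^sup>2 / q x) * ennreal (u\<^sup>2) \<partial>?U)"
    proof (rule nn_integral_cong_AE, use AE_u in eventually_elim)
      fix u :: real assume u: "0 \<le> u"
      have "a + (b - c * (u / q x))\<^sup>2 * q x + 2 * b * c * u = a + b\<^sup>2 * q x + c\<^sup>2 / q x * u\<^sup>2"
        using qx by (simp add: field_simps power2_eq_square)
      then show "ennreal (a + (b - c * (u / q x))\<^sup>2 * q x) + ennreal (2 * b * c) * ennreal u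
          = ennreal (a + b\<^sup>2 * q x) + ennreal (c\<^sup>2 / q x) * ennreal (u\<^sup>2)"
        using a b c u qx by (simp add: ennreal_mult[symmetric] ennreal_plus[symmetric] del: ennreal_plus)
    qed
    also have "\<dots> = ennreal (a + b\<^sup>2 * q x) + ennreal (c\<^sup>2 / q x) * ennreal (real n * (real n + 2) * \<sigma>^4)"
      using U.emeasure_space_1
      by (simp add: nn_integral_add nn_integral_cmult scaled_chi_square_moments del: ennreal_plus)
    also have "\<dots> = ennreal a + ennreal (b\<^sup>2) * ennreal (q x) + ennreal C * inverse (ennreal (q x))"
    proof -
      have "C * inverse (q x) = c\<^sup>2 / q x * (real n * (real n + 2) * \<sigma>^4)"
        by (simp add: C_def divide_inverse)
      then show ?thesis
        using a qx C by (simp add: inverse_ennreal ennreal_mult[symmetric])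
    qed
    finally show ?thesis .
  qed
  define B where "B = a + b\<^sup>2 * (real p * V) + C / ((real p - 2) * V)"
  have "(\<integral>\<^sup>+x. F x \<partial>?M) + ennreal K = (\<integral>\<^sup>+x. F x + ennreal K \<partial>?M)"
    using M.emeasure_space_1 unfolding F_def by (subst nn_integral_add) auto
  also have "\<dots> = (\<integral>\<^sup>+x. ennreal a + ennreal (b\<^sup>2) * ennreal (q x) + ennreal C * inverse (ennreal (q x)) \<partial>?M)"
    by (rule nn_integral_cong_AE, use AE_q in eventually_elim) (rule F)
  also have "\<dots> = ennreal a + ennreal (b\<^sup>2) * ennreal (real p * V) + ennreal C * ennreal (1 / ((real p - 2) * V))"
  proof -
    have "(\<integral>\<^sup>+x. ennreal (q x) \<partial>?M) = ennreal (real p * V)"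
      using nn_integral_normal_vec_sq_norm_diff[of "sqrt V" p \<nu> \<nu>] V by (simp add: q_def sq_norm_def)
    then show ?thesis
      using M.emeasure_space_1 inv by (simp add: nn_integral_add nn_integral_cmult)
  qed
  also have "\<dots> = ennreal B"
    using a V C p unfolding B_def
    by (simp add: ennreal_mult[symmetric] ennreal_plus[symmetric] del: ennreal_plus)
  finally have sum: "(\<integral>\<^sup>+x. F x \<partial>?M) + ennreal K = ennreal B" .
  then have "(\<integral>\<^sup>+x. F x \<partial>?M) < top"
    by (metis ennreal_less_top ennreal_add_eq_top less_top)
  then obtain r where r: "0 \<le> r" "(\<integral>\<^sup>+x. F x \<partial>?M) = ennreal r"
    by (cases "\<integral>\<^sup>+x. F x \<partial>?M") auto
  have "0 \<le> B" using a b C V p by (simp add: B_def)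
  with sum r K have "r + K = B"
    by (simp add: ennreal_plus[symmetric] del: ennreal_plus)
  moreover have "B - K = real p * \<sigma>\<^sup>2 - \<sigma>^4 / V * (real n * (real p - 2) / (real n + 2))"
  proof -
    define P N where "P = real p - 2" and "N = real n + 2"
    have PN: "P \<noteq> 0" "N \<noteq> 0" using p by (auto simp: P_def N_def)
    have "C / (P * V) = \<sigma>^4 / V * (real n * P / N)"
      using PN V unfolding C_def c_def P_def[symmetric] N_def[symmetric]
      by (simp add: field_simps power2_eq_square)
    moreover have "K = 2 * (\<sigma>^4 / V * (real n * P / N))"
      unfolding K_def b_def c_def P_def N_def by (simp add: power4_eq_xxxx power2_eq_square)
    moreover have "a + b\<^sup>2 * (real p * V) = real p * \<sigma>\<^sup>2"
    proof -
      have "a + b\<^sup>2 * (real p * V) = real p * \<sigma>\<^sup>2 * ((\<sigma>\<^sup>2 + \<tau>\<^sup>2) / V)"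
        using V unfolding a_def b_def by (simp add: field_simps power2_eq_square)
      then show ?thesis using V by (simp add: V_def[symmetric])
    qed
    ultimately show ?thesis by (simp add: B_def P_def N_def)
  qed
  ultimately show ?thesis
    unfolding risk r(2) V_def[symmetric] by (metis add_diff_cancel_right')
qed

theorem theorem4:
  shows
    "(\<forall>p n. \<forall>\<nu> :: nat \<Rightarrow> real. \<forall>\<tau> \<sigma> :: real.
        3 \<le> p \<and> 1 \<le> n \<and> 0 < \<tau> \<and> 0 < \<sigma> \<longrightarrow>
          bayes_risk p n \<nu> \<tau> \<sigma> (emp_mod_bayes p n \<nu>) \<le> bayes_risk p n \<nu> \<tau> \<sigma> mle \<and>
          bayes_risk p n \<nu> \<tau> \<sigma> mle = ennreal (real p * \<sigma>\<^sup>2))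
     \<and>
     (\<forall>\<nu> :: nat \<Rightarrow> nat \<Rightarrow> nat \<Rightarrow> real. \<forall>\<tau> \<sigma> :: real.
        0 < \<tau> \<and> 0 < \<sigma> \<longrightarrow>
          ((\<lambda>(n, p). bayes_risk p n (\<nu> n p) \<tau> \<sigma> (emp_mod_bayes p n (\<nu> n p))
                       / bayes_risk p n (\<nu> n p) \<tau> \<sigma> mle)
             \<longlongrightarrow> ennreal (\<tau>\<^sup>2 / (\<tau>\<^sup>2 + \<sigma>\<^sup>2))) (sequentially \<times>\<^sub>F sequentially))"
proof (intro conjI allI impI; elim conjE)
  fix p n :: nat and \<nu> :: "nat \<Rightarrow> real" and \<tau> \<sigma> :: real
  assume p: "3 \<le> p" and t: "0 < \<tau>" and s: "0 < \<sigma>"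
  show "bayes_risk p n \<nu> \<tau> \<sigma> mle = ennreal (real p * \<sigma>\<^sup>2)"
    by (rule bayes_risk_mle[OF s t])
  have "0 \<le> \<sigma>^4 / (\<sigma>\<^sup>2 + \<tau>\<^sup>2) * (real n * (real p - 2) / (real n + 2))"
    using p by (intro mult_nonneg_nonneg divide_nonneg_nonneg) auto
  then show "bayes_risk p n \<nu> \<tau> \<sigma> (emp_mod_bayes p n \<nu>) \<le> bayes_risk p n \<nu> \<tau> \<sigma> mle"
    unfolding bayes_risk_mle[OF s t] bayes_risk_emp_mod_bayes[OF s t p]
    by (intro ennreal_leI) simp
next
  fix \<nu> :: "nat \<Rightarrow> nat \<Rightarrow> nat \<Rightarrow> real" and \<tau> \<sigma> :: real
  assume t: "0 < \<tau>" and s: "0 < \<sigma>"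
  define V where "V = \<sigma>\<^sup>2 + \<tau>\<^sup>2"
  have V: "0 < V" using s by (simp add: V_def add_pos_nonneg)
  define ratio where "ratio = (\<lambda>(n, p). 1 - \<sigma>\<^sup>2 / V * (real n / (real n + 2) * ((real p - 2) / real p)))"
  have "((\<lambda>w. 1 - \<sigma>\<^sup>2 / V * (real (fst w) / (real (fst w) + 2) * ((real (snd w) - 2) / real (snd w))))
      \<longlongrightarrow> 1 - \<sigma>\<^sup>2 / V * (1 * 1)) (sequentially \<times>\<^sub>F sequentially)"
  proof (intro tendsto_intros)
    have "(\<lambda>n. real n / (real n + 2)) \<longlonglongrightarrow> 1" by real_asymp
    from filterlim_compose[OF this filterlim_fst]
    show "((\<lambda>w. real (fst w) / (real (fst w) + 2)) \<longlongrightarrow> 1) (sequentially \<times>\<^sub>F sequentially)" .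
    have "(\<lambda>p. (real p - 2) / real p) \<longlonglongrightarrow> 1" by real_asymp
    from filterlim_compose[OF this filterlim_snd]
    show "((\<lambda>w. (real (snd w) - 2) / real (snd w)) \<longlongrightarrow> 1) (sequentially \<times>\<^sub>F sequentially)" .
  qed
  moreover have "1 - \<sigma>\<^sup>2 / V * (1 * 1) = \<tau>\<^sup>2 / (\<tau>\<^sup>2 + \<sigma>\<^sup>2)"
  proof -
    have "1 - \<sigma>\<^sup>2 / V * (1 * 1) = (V - \<sigma>\<^sup>2) / V"
      using V by (simp add: diff_divide_distrib)
    then show ?thesis by (simp add: V_def add.commute)
  qed
  ultimately have lim: "((\<lambda>w. ennreal (ratio w)) \<longlongrightarrow> ennreal (\<tau>\<^sup>2 / (\<tau>\<^sup>2 + \<sigma>\<^sup>2))) (sequentially \<times>\<^sub>F sequentially)"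
    by (intro tendsto_ennrealI) (simp add: ratio_def case_prod_beta)
  have "eventually (\<lambda>w. 3 \<le> snd w) (sequentially \<times>\<^sub>F sequentially)"
    using eventually_compose_filterlim[OF eventually_ge_at_top filterlim_snd] .
  then have ev: "eventually (\<lambda>w. ennreal (ratio w) =
      (case w of (n, p) \<Rightarrow> bayes_risk p n (\<nu> n p) \<tau> \<sigma> (emp_mod_bayes p n (\<nu> n p))
                       / bayes_risk p n (\<nu> n p) \<tau> \<sigma> mle)) (sequentially \<times>\<^sub>F sequentially)"
  proof eventually_elim
    fix w :: "nat \<times> nat" assume w: "3 \<le> snd w"
    obtain n p where [simp]: "w = (n, p)" by (cases w)
    have p: "3 \<le> p" using w by simp
    have "\<sigma>\<^sup>2 / V * (real n / (real n + 2) * ((real p - 2) / real p)) \<le> 1 * (1 * 1)"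
      using p V by (intro mult_mono) (auto simp: V_def)
    then have r: "0 \<le> ratio (n, p)" by (simp add: ratio_def)
    have "real p * \<sigma>\<^sup>2 - \<sigma>^4 / V * (real n * (real p - 2) / (real n + 2)) = ratio (n, p) * (real p * \<sigma>\<^sup>2)"
      using p V unfolding ratio_def by (simp add: divide_simps power4_eq_xxxx power2_eq_square) (simp add: algebra_simps)
    then show "ennreal (ratio w) =
      (case w of (n, p) \<Rightarrow> bayes_risk p n (\<nu> n p) \<tau> \<sigma> (emp_mod_bayes p n (\<nu> n p))
                       / bayes_risk p n (\<nu> n p) \<tau> \<sigma> mle)"
      using p s r by (simp add: bayes_risk_mle[OF s t] bayes_risk_emp_mod_bayes[OF s t p] V_def[symmetric]
          divide_ennreal)
  qed
  show "((\<lambda>(n, p). bayes_risk p n (\<nu> n p) \<tau> \<sigma> (emp_mod_bayes p n (\<nu> n p))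
                       / bayes_risk p n (\<nu> n p) \<tau> \<sigma> mle)
             \<longlongrightarrow> ennreal (\<tau>\<^sup>2 / (\<tau>\<^sup>2 + \<sigma>\<^sup>2))) (sequentially \<times>\<^sub>F sequentially)"
    using lim ev by (rule Lim_transform_eventually)
qed

end
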